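(* Set $$\widehat\Psi_0^{\mathrm{cyc}}(y):=\frac1{1-y},\qquad \widehat\Psi_s^{\mathrm{cyc}}(y):=\frac{2}{s+2}\Psi_s^{\mathrm{cyc}}(y)\quad(s\ge1).$$ (1) For every integer $s\ge1$, as formal power series in $y$, $$\widehat\Psi_s^{\mathrm{cyc}}(y)=\frac{1+(1+y)\widehat\Psi_{s-1}^{\mathrm{cyc}}(y)}{1-y-y(1+y)\widehat\Psi_{s-1}^{\mathrm{cyc}}(y)}.$$ Equivalently, with $\Psi_0^{\mathrm{cyc}}(y):=\frac1{1-y}$, for every $s\ge1$, $$\Psi_s^{\mathrm{cyc}}(y)=\frac{(s+2)\bigl((s+1)+2(1+y)\Psi_{s-1}^{\mathrm{cyc}}(y)\bigr)}{2\bigl((s+1)(1-y)-2y(1+y)\Psi_{s-1}^{\mathrm{cyc}}(y)\bigr)}.$$ (2) Let $s\ge1$ and $\nu_s:=\lfloor (s+2)/2\rfloor$, so that $Q_{s+2}(-y)=\sum_{j=0}^{\nu_s}(-1)^j\binom{s+2}{2j}y^j$. If a cyclic generating function (that is, $\Psi_s^{\mathrm{cyc}}$ or $\Omega_s^{\mathrm{cyc}}$) has the form $\sum_{m\ge1}a_m y^{m-1}=\dfrac{A(y)}{Q_{s+2}(-y)}$ with $A(y)$ a polynomial, then $$a_m=\sum_{j=1}^{\nu_s}(-1)^{j+1}\binom{s+2}{2j}a_{m-j}\qquad\text{for all } m\ge\deg A+2,$$ where $a_k:=0$ for $k\le0$. In particular, for the even cyclic sequence $a_m=N_{2m}^{\mathrm{cyc}}(s)$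 this recurrence holds for all $m\ge\nu_s+1$; for the odd cyclic sequence $a_m=N_{2m+1}^{\mathrm{cyc}}(s)$ the same recurrence holds after the finitely many initial terms determined by the numerator of $\Omega_s^{\mathrm{cyc}}$, i.e. for all $m\ge\deg A+2$ where $A(y)=Q_{s+2}(-y)\,\Omega_s^{\mathrm{cyc}}(y)$, which is a polynomial.
   Context: For integers $d\ge2$ and $s\ge1$ let $$\mathcal P_d^{(s)}=\{x=(x_1,\dots,x_d)\in\mathbb R_{\ge0}^d:\ x_i+x_{i+1}\le s+\delta_i,\ 1\le i\le d-1\},$$ where $\delta_i=0$ for $i$ odd and $\delta_i=1$ for $i$ even. Define $$N_d^{\mathrm{cyc}}(s):=\#\bigl(\{x\in\mathcal P_d^{(s)}:\ x_d+x_1\le s+\delta_d\}\cap\mathbb Z^d\bigr),$$ and, for $s\ge1$, $$\Psi_s^{\mathrm{cyc}}(y):=\sum_{m\ge1}N_{2m}^{\mathrm{cyc}}(s)\,y^{m-1},\qquad \Omega_s^{\mathrm{cyc}}(y):=\sum_{m\ge1}N_{2m+1}^{\mathrm{cyc}}(s)\,y^{m-1}.$$ Also $Q_n(y):=\sum_{k=0}^{\lfloor n/2\rfloor}\binom{n}{2k}y^k$. *)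

theory Defs
  imports "HOL-Analysis.Analysis" "HOL-Computational_Algebra.Computational_Algebra"
begin

definition \<delta> :: "nat \<Rightarrow> nat" where
  "\<delta> i = (if odd i then 0 else 1)"

(* A point of R^d is an extensional function on the coordinates {1..d}. *)
definition polytope_P :: "nat \<Rightarrow> nat \<Rightarrow> (nat \<Rightarrow> real) set" where
  "polytope_P d s =
     {x \<in> {1..d} \<rightarrow>\<^sub>E {0..}. \<forall>i\<in>{1..d-1}. x i + x (i + 1) \<le> real (s + \<delta> i)}"

definition N_cyc :: "nat \<Rightarrow> nat \<Rightarrow> nat" where
  "N_cyc d s =
     card ({x \<in> polytope_P d s. x d + x 1 \<le> real (s + \<delta> d)} \<inter> ({1..d} \<rightarrow>\<^sub>E \<int>))"

(* The value at s = 0 is the separate convention Psi_0 = 1/(1-y).  The coefficient of y^n is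
   N_{2m} with m = n + 1. *)
definition Psi_cyc :: "nat \<Rightarrow> real fps" where
  "Psi_cyc s =
     (if s = 0 then 1 / (1 - fps_X) else Abs_fps (\<lambda>n. real (N_cyc (2 * (n + 1)) s)))"

definition Omega_cyc :: "nat \<Rightarrow> real fps" where
  "Omega_cyc s = Abs_fps (\<lambda>n. real (N_cyc (2 * (n + 1) + 1) s))"

definition Psi_hat_cyc :: "nat \<Rightarrow> real fps" where
  "Psi_hat_cyc s =
     (if s = 0 then 1 / (1 - fps_X) else fps_const (2 / (real s + 2)) * Psi_cyc s)"

definition Q :: "nat \<Rightarrow> real poly" where
  "Q n = (\<Sum>k = 0..n div 2. monom (real (n choose (2 * k))) k)"

(* Q_n(-y) *)
definition Q_neg :: "nat \<Rightarrow> real poly" where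
  "Q_neg n = pcompose (Q n) [:0, -1:]"

definition \<nu> :: "nat \<Rightarrow> nat" where
  "\<nu> s = (s + 2) div 2"

(* The recurrence at index m for a sequence a_1, a_2, ...; the value of a at 0 is ignored,
   since a_k is read as 0 for k <= 0. *)
definition cyc_recurrence_at :: "nat \<Rightarrow> (nat \<Rightarrow> real) \<Rightarrow> nat \<Rightarrow> bool" where
  "cyc_recurrence_at s a m \<longleftrightarrow>
     a m = (\<Sum>j = 1..\<nu> s. (-1) ^ (j + 1) * real ((s + 2) choose (2 * j)) *
              (if j < m then a (m - j) else 0))"

end

theory Submission
  imports Defs
begin

text \<open>
  Write \<open>q\<^sub>n = Q\<^sub>n(-y)\<close> and \<open>r\<^sub>n\<close> for its companion built from the odd binomial coefficients,
  so that \<open>(1 + \<i>\<surd>y)\<^sup>n = q\<^sub>n + \<i>\<surd>y r\<^sub>n\<close>. Everything follows from the closed form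
  \<open>q\<^sub>s\<^sub>+\<^sub>2 \<Psi>\<^sub>s = (s + 2) / 2 \<cdot> r\<^sub>s\<^sub>+\<^sub>1\<close>
  (\<open>Psi_cyc_closed_form\<close>) and its analogue for \<open>\<Omega>\<^sub>s\<close>, which has the same
  denominator (\<open>Omega_cyc_numerator\<close>).

  A lattice point counted by \<open>N\<^sub>d\<close> is a closed walk of length \<open>d\<close> on \<open>{0..s}\<close> whose steps are
  alternately of the form \<open>x + x' \<le> s\<close> and \<open>x + x' \<le> s + 1\<close> (\<open>N_cyc_eq_sum_walks\<close>), so
  \<open>N\<^sub>2\<^sub>m\<close> is the trace of the \<open>m\<close>-th power of a double-step matrix and \<open>\<Psi>\<^sub>s\<close> comes from the trace of
  its resolvent. Rather than through eigenvalues, the resolvent is found entry by entry. Let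
  \<open>h(b)\<close> be the generating function of walks of even length from \<open>a\<close> to \<open>b\<close>, and
  \<open>H(k) = h(0) + \<dots> + h(k - 1)\<close>. Because each step condition is a threshold,
  subtracting neighbouring equations gives \<open>h(b) - h(b + 1) = y H(b)\<close> apart from the source terms
  at \<open>b = a\<close> and \<open>b = a - 1\<close>, that is, \<open>H(k + 2) = 2 H(k + 1) - (1 + y) H(k)\<close>. This is the recurrence
  satisfied by \<open>q\<close> and \<open>r\<close>; so \<open>H\<close> is a multiple of \<open>r\<close> plus a shifted copy of \<open>q\<close> started by
  the source, and the boundary condition at \<open>s + 1\<close> fixes the multiple, with denominator \<open>q\<^sub>s\<^sub>+\<^sub>2\<close>
  (\<open>walk_gf_closed_form\<close>).

  The trace is then the convolution of \<open>q\<close> and \<open>r\<close>, which the addition theorem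
  \<open>r\<^sub>m\<^sub>+\<^sub>n = q\<^sub>m r\<^sub>n + r\<^sub>m q\<^sub>n\<close> evaluates (\<open>sum_Q_neg_R_neg\<close>). Hence \<open>\<Psi>\<close>, normalised by the factor
  \<open>2 / (s + 2)\<close>, is \<open>r\<^sub>s\<^sub>+\<^sub>1 / q\<^sub>s\<^sub>+\<^sub>2\<close>, and the nonlinear recursion in \<open>s\<close> merely expresses
  \<open>r\<^sub>n\<^sub>+\<^sub>1 = r\<^sub>n + q\<^sub>n\<close> and \<open>q\<^sub>n\<^sub>+\<^sub>1 = q\<^sub>n - y r\<^sub>n\<close> in terms of these quotients. The linear recurrences state that the
  coefficients of a polynomial numerator vanish beyond its degree.
\<close>

section \<open>Lattice points as closed walks\<close>

text \<open>
  The \<open>c\<close> summed over is bounded by \<open>s\<close>, but the endpoint \<open>b\<close> is not. The fictitious endpoint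
  \<open>b = s + 1\<close> supplies the boundary condition for the difference equation in \<open>b\<close>.
\<close>

primrec walks :: "nat \<Rightarrow> nat \<Rightarrow> nat \<Rightarrow> nat \<Rightarrow> nat" where
  "walks s a 0 b = (if b = a then 1 else 0)"
| "walks s a (Suc d) b = (\<Sum>c | c \<le> s \<and> c + b \<le> s + \<delta> (Suc d). walks s a d c)"

definition lattice_paths :: "nat \<Rightarrow> nat \<Rightarrow> nat \<Rightarrow> nat \<Rightarrow> (nat \<Rightarrow> nat) set" where
  "lattice_paths s a d b =
     {x \<in> {1..Suc d} \<rightarrow>\<^sub>E {0..s}. x 1 = a \<and> x (Suc d) = b \<and>
        (\<forall>i\<in>{1..d}. x i + x (Suc i) \<le> s + \<delta> i)}"

lemma finite_lattice_paths: "finite (lattice_paths s a d b)"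
  by (rule finite_subset[of _ "{1..Suc d} \<rightarrow>\<^sub>E {0..s}"])
     (auto simp: lattice_paths_def intro!: finite_PiE)

lemma lattice_paths_Suc:
  assumes "b \<le> s"
  shows "lattice_paths s a (Suc d) b =
    (\<Union>c\<in>{c. c \<le> s \<and> c + b \<le> s + \<delta> (Suc d)}.
       (\<lambda>x. x(Suc (Suc d) := b)) ` lattice_paths s a d c)" (is "?L = ?R")
proof
  show "?L \<subseteq> ?R"
  proof
    fix x assume x: "x \<in> ?L"
    define y where "y = x(Suc (Suc d) := undefined)"
    have "x = y(Suc (Suc d) := b)"
      using x by (auto simp: y_def lattice_paths_def)
    moreover have "y \<in> lattice_paths s a d (x (Suc d))"
      using x by (fastforce simp: y_def lattice_paths_def PiE_iff extensional_def)
    moreover have "x (Suc d) \<le> s" "x (Suc d) + b \<le> s + \<delta> (Suc d)"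
      using x by (auto simp: lattice_paths_def PiE_iff)
    ultimately show "x \<in> ?R" by blast
  qed
next
  show "?R \<subseteq> ?L"
  proof
    fix x assume "x \<in> ?R"
    then obtain c y where c: "c \<le> s" "c + b \<le> s + \<delta> (Suc d)"
      and y: "y \<in> lattice_paths s a d c" and x: "x = y(Suc (Suc d) := b)" by blast
    have "x \<in> {1..Suc (Suc d)} \<rightarrow>\<^sub>E {0..s}"
      using y assms by (auto simp: x lattice_paths_def PiE_iff extensional_def)
    moreover have "x i + x (Suc i) \<le> s + \<delta> i" if "i \<in> {1..Suc d}" for i
      using that y c by (cases "i = Suc d") (auto simp: x lattice_paths_def)
    ultimately show "x \<in> ?L"
      using y by (simp add: x lattice_paths_def)
  qed
qed

text \<open>Lattice paths are split by their last vertex but one, which turns the count into the recursion of \<open>walks\<close>.\<close>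

lemma card_lattice_paths:
  assumes "a \<le> s" "b \<le> s"
  shows "card (lattice_paths s a d b) = walks s a d b"
  using assms(2)
proof (induction d arbitrary: b)
  case 0
  have "lattice_paths s a 0 b = (if b = a then {\<lambda>i. if i = 1 then a else undefined} else {})"
    using assms(1) by (auto simp: lattice_paths_def PiE_iff extensional_def fun_eq_iff)
  then show ?case by simp
next
  case (Suc d)
  let ?C = "{c. c \<le> s \<and> c + b \<le> s + \<delta> (Suc d)}"
  let ?u = "\<lambda>x :: nat \<Rightarrow> nat. x(Suc (Suc d) := b)"
  have inj: "inj_on ?u (\<Union>c. lattice_paths s a d c)"
  proof (rule inj_onI)
    fix x y assume xy: "x \<in> (\<Union>c. lattice_paths s a d c)" "y \<in> (\<Union>c. lattice_paths s a d c)"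
      and eq: "?u x = ?u y"
    have "x (Suc (Suc d)) = y (Suc (Suc d))"
      using xy by (auto simp: lattice_paths_def PiE_iff extensional_def)
    with eq show "x = y" by (metis fun_upd_triv fun_upd_upd)
  qed
  have disj: "?u ` lattice_paths s a d c \<inter> ?u ` lattice_paths s a d c' = {}"
    if "c \<noteq> c'" for c c'
  proof -
    have "lattice_paths s a d c \<inter> lattice_paths s a d c' = {}"
      using that by (auto simp: lattice_paths_def)
    then show ?thesis
      using inj_on_image_Int[OF inj, of "lattice_paths s a d c" "lattice_paths s a d c'"] by auto
  qed
  have "card (lattice_paths s a (Suc d) b) = (\<Sum>c\<in>?C. card (?u ` lattice_paths s a d c))"
    unfolding lattice_paths_Suc[OF Suc.prems]
    by (rule card_UN_disjoint) (use disj in \<open>auto simp: finite_lattice_paths\<close>)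
  also have "\<dots> = (\<Sum>c\<in>?C. walks s a d c)"
  proof (rule sum.cong[OF refl])
    fix c assume "c \<in> ?C"
    then show "card (?u ` lattice_paths s a d c) = walks s a d c"
      using card_image[OF inj_on_subset[OF inj], of "lattice_paths s a d c"] Suc.IH[of c] by auto
  qed
  finally show ?case by simp
qed

text \<open>
  Splitting by the values \<open>a\<close> and \<open>b\<close> of the first and last coordinate leaves lattice paths from \<open>a\<close> to \<open>b\<close>;
  the cyclic constraint between \<open>b\<close> and \<open>a\<close> is one further step of the walk, back to \<open>a\<close>.
\<close>

lemma N_cyc_eq_sum_walks:
  assumes "n \<ge> 1"
  shows "N_cyc (Suc n) s = (\<Sum>a\<le>s. walks s a (Suc n) a)"
proof -
  define S where "S = {x \<in> polytope_P (Suc n) s. x (Suc n) + x 1 \<le> real (s + \<delta> (Suc n))}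
     \<inter> ({1..Suc n} \<rightarrow>\<^sub>E \<int>)"
  define E where "E = (\<lambda>a. {b. b \<le> s \<and> b + a \<le> s + \<delta> (Suc n)})"
  define T where "T = (\<lambda>a. \<Union>b\<in>E a. lattice_paths s a n b)"
  define \<rho> where "\<rho> = (\<lambda>(x :: nat \<Rightarrow> nat). restrict (\<lambda>i. real (x i)) {1..Suc n})"
  have inj: "inj_on \<rho> (\<Union>a\<le>s. T a)"
  proof (rule inj_onI)
    fix x y assume xy: "x \<in> (\<Union>a\<le>s. T a)" "y \<in> (\<Union>a\<le>s. T a)" and eq: "\<rho> x = \<rho> y"
    have ext: "x \<in> extensional {1..Suc n}" "y \<in> extensional {1..Suc n}"
      using xy by (auto simp: T_def lattice_paths_def PiE_iff)
    have "x i = y i" if "i \<in> {1..Suc n}" for i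
      using fun_cong[OF eq, of i] that by (auto simp: \<rho>_def)
    with ext show "x = y" by (rule extensionalityI)
  qed
  have "S = \<rho> ` (\<Union>a\<le>s. T a)"
  proof
    show "S \<subseteq> \<rho> ` (\<Union>a\<le>s. T a)"
    proof
      fix x assume x: "x \<in> S"
      define y where "y = restrict (\<lambda>i. nat \<lfloor>x i\<rfloor>) {1..Suc n}"
      have xy: "x i = real (y i)" if "i \<in> {1..Suc n}" for i
      proof -
        have "x i \<in> \<int>" "x i \<ge> 0"
          using x that unfolding S_def polytope_P_def by (auto simp: PiE_iff)
        then show ?thesis using that by (auto simp: y_def elim: Ints_cases)
      qed
      have step: "y i + y (Suc i) \<le> s + \<delta> i" if "i \<in> {1..n}" for i
      proof -
        have "x i + x (Suc i) \<le> real (s + \<delta> i)"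
          using x that unfolding S_def polytope_P_def by auto
        then show ?thesis using xy[of i] xy[of "Suc i"] that by simp
      qed
      have close: "y (Suc n) + y 1 \<le> s + \<delta> (Suc n)"
      proof -
        have "x (Suc n) + x 1 \<le> real (s + \<delta> (Suc n))"
          using x unfolding S_def by auto
        then show ?thesis using xy[of 1] xy[of "Suc n"] by simp
      qed
      \<comment> \<open>Every vertex of the cycle lies on an edge of odd index, whose bound is \<open>s\<close>.\<close>
      have bound: "y i \<le> s" if i: "i \<in> {1..Suc n}" for i
      proof (cases "odd i")
        case True
        then show ?thesis
          using i step[of i] close by (cases "i = Suc n") (auto simp: \<delta>_def)
      next
        case False
        then obtain j where "i = Suc j" "odd j" using i by (cases i) auto
        then show ?thesis using i step[of j] by (cases j) (auto simp: \<delta>_def)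
      qed
      have "y \<in> lattice_paths s (y 1) n (y (Suc n))"
        using step bound by (auto simp: lattice_paths_def PiE_iff y_def)
      then have "y \<in> T (y 1)"
        using close bound[of "Suc n"] by (auto simp: T_def E_def)
      moreover have "y 1 \<le> s" using bound[of 1] by simp
      moreover have "x = \<rho> y"
      proof (rule extensionalityI[of _ "{1..Suc n}"])
        show "x \<in> extensional {1..Suc n}"
          using x unfolding S_def by (auto simp: PiE_iff)
      qed (auto simp: \<rho>_def xy)
      ultimately show "x \<in> \<rho> ` (\<Union>a\<le>s. T a)" by blast
    qed
  next
    show "\<rho> ` (\<Union>a\<le>s. T a) \<subseteq> S"
    proof
      fix x assume "x \<in> \<rho> ` (\<Union>a\<le>s. T a)"
      then obtain y a b where y: "y \<in> lattice_paths s a n b" "b \<in> E a" and x: "x = \<rho> y"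
        by (auto simp: T_def)
      have xi: "x i = real (y i)" if "i \<in> {1..Suc n}" for i
        using that by (simp add: x \<rho>_def)
      have "x \<in> extensional {1..Suc n}" by (simp add: x \<rho>_def)
      moreover have "x i + x (i + 1) \<le> real (s + \<delta> i)" if "i \<in> {1..n}" for i
      proof -
        have "y i + y (Suc i) \<le> s + \<delta> i" using y that by (auto simp: lattice_paths_def)
        then show ?thesis using xi[of i] xi[of "Suc i"] that by simp
      qed
      moreover have "x (Suc n) + x 1 \<le> real (s + \<delta> (Suc n))"
      proof -
        have "y (Suc n) + y 1 \<le> s + \<delta> (Suc n)"
          using y by (auto simp: lattice_paths_def E_def)
        then show ?thesis using xi[of 1] xi[of "Suc n"] by simp
      qed
      ultimately show "x \<in> S"
        unfolding S_def polytope_P_def by (auto simp: PiE_iff xi)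
    qed
  qed
  then have "card S = card (\<Union>a\<le>s. T a)"
    by (simp add: card_image[OF inj])
  also have "\<dots> = (\<Sum>a\<le>s. card (T a))"
    by (rule card_UN_disjoint) (auto simp: T_def E_def finite_lattice_paths, auto simp: lattice_paths_def)
  also have "\<dots> = (\<Sum>a\<le>s. \<Sum>b\<in>E a. card (lattice_paths s a n b))"
    unfolding T_def
    by (intro sum.cong refl card_UN_disjoint)
       (auto simp: E_def finite_lattice_paths, auto simp: lattice_paths_def)
  also have "\<dots> = (\<Sum>a\<le>s. walks s a (Suc n) a)"
    by (intro sum.cong refl) (simp add: E_def card_lattice_paths)
  finally show ?thesis by (simp add: N_cyc_def S_def)
qed

section \<open>The polynomials \<open>Q\<^sub>n(-y)\<close> and their companions\<close>

text \<open>With \<open>Q_neg n\<close> as real part, \<open>R_neg n\<close> is the imaginary part of \<open>(1 + \<i>\<surd>y)\<^sup>n\<close> divided by \<open>\<surd>y\<close>.\<close>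

definition R_neg :: "nat \<Rightarrow> real poly" where
  "R_neg n = (\<Sum>k = 0..n div 2. monom ((-1) ^ k * real (n choose (2 * k + 1))) k)"

lemma Q_neg_eq_sum:
  "Q_neg n = (\<Sum>k = 0..n div 2. monom ((-1) ^ k * real (n choose (2 * k))) k)"
  by (rule poly_eqI)
     (auto simp: Q_neg_def Q_def coeff_pcompose_linear coeff_sum sum.delta' if_distrib cong: if_cong)

lemma coeff_Q_neg: "coeff (Q_neg n) k = (-1) ^ k * real (n choose (2 * k))"
  by (auto simp: Q_neg_eq_sum coeff_sum sum.delta' binomial_eq_0 if_distrib cong: if_cong)

lemma coeff_R_neg: "coeff (R_neg n) k = (-1) ^ k * real (n choose (2 * k + 1))"
  by (auto simp: R_neg_def coeff_sum sum.delta' binomial_eq_0 if_distrib cong: if_cong)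

lemma Q_neg_0 [simp]: "Q_neg 0 = 1" and R_neg_0 [simp]: "R_neg 0 = 0"
  by (simp_all add: Q_neg_eq_sum R_neg_def)

lemma Q_neg_Suc: "Q_neg (Suc n) = Q_neg n - [:0, 1:] * R_neg n"
proof (rule poly_eqI)
  fix k show "coeff (Q_neg (Suc n)) k = coeff (Q_neg n - [:0, 1:] * R_neg n) k"
    by (cases k) (auto simp: coeff_Q_neg coeff_R_neg algebra_simps)
qed

lemma R_neg_Suc: "R_neg (Suc n) = R_neg n + Q_neg n"
  by (rule poly_eqI) (auto simp: coeff_Q_neg coeff_R_neg algebra_simps)

text \<open>Real and imaginary part of \<open>(1 + \<i>\<surd>y)\<^sup>m\<^sup>+\<^sup>n = (1 + \<i>\<surd>y)\<^sup>m (1 + \<i>\<surd>y)\<^sup>n\<close>.\<close>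

lemma Q_R_neg_add:
  "Q_neg (m + n) = Q_neg m * Q_neg n - [:0, 1:] * R_neg m * R_neg n"
  "R_neg (m + n) = Q_neg m * R_neg n + R_neg m * Q_neg n"
proof (induction m)
  case (Suc m)
  { case 1 show ?case unfolding add_Suc Q_neg_Suc R_neg_Suc Suc.IH by algebra }
  { case 2 show ?case unfolding add_Suc Q_neg_Suc R_neg_Suc Suc.IH by algebra }
qed simp_all

text \<open>
  Adding the sum to its own reversal makes every summand an instance of the addition theorem for
  \<open>R_neg\<close>. This is the origin of the factor \<open>(s + 2) / 2\<close> in the closed form of \<open>\<Psi>\<^sub>s\<close>.
\<close>

lemma sum_Q_neg_R_neg:
  "2 * (\<Sum>a\<le>n. Q_neg a * R_neg (n - a)) = of_nat (Suc n) * R_neg n"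
proof -
  have "(\<Sum>a\<le>n. Q_neg a * R_neg (n - a)) = (\<Sum>a\<le>n. R_neg a * Q_neg (n - a))"
    by (subst sum.nat_diff_reindex[symmetric, where n = "Suc n", simplified lessThan_Suc_atMost])
       (auto intro!: sum.cong simp: mult.commute)
  then have "2 * (\<Sum>a\<le>n. Q_neg a * R_neg (n - a)) =
      (\<Sum>a\<le>n. Q_neg a * R_neg (n - a) + R_neg a * Q_neg (n - a))"
    by (simp add: sum.distrib)
  also have "\<dots> = (\<Sum>a\<le>n. R_neg n)"
    by (rule sum.cong) (auto simp flip: Q_R_neg_add(2))
  finally show ?thesis by simp
qed

abbreviation Q_fps :: "nat \<Rightarrow> real fps" where "Q_fps n \<equiv> fps_of_poly (Q_neg n)"
abbreviation R_fps :: "nat \<Rightarrow> real fps" where "R_fps n \<equiv> fps_of_poly (R_neg n)"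

lemma Q_fps_Suc: "Q_fps (Suc n) = Q_fps n - fps_X * R_fps n"
  by (simp only: Q_neg_Suc fps_of_poly_diff fps_of_poly_mult fps_of_poly_fps_X)

lemma R_fps_Suc: "R_fps (Suc n) = R_fps n + Q_fps n"
  by (simp only: R_neg_Suc fps_of_poly_add)

lemma Q_fps_Suc_Suc: "Q_fps (Suc (Suc n)) = 2 * Q_fps (Suc n) - (1 + fps_X) * Q_fps n"
  and R_fps_Suc_Suc: "R_fps (Suc (Suc n)) = 2 * R_fps (Suc n) - (1 + fps_X) * R_fps n"
  unfolding Q_fps_Suc R_fps_Suc by algebra+

lemma Q_fps_nth_0: "fps_nth (Q_fps n) 0 = 1"
  by (simp add: coeff_Q_neg)

lemma Q_fps_nonzero: "Q_fps n \<noteq> 0"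
  using Q_fps_nth_0[of n] by auto

section \<open>The generating function of walks of even length\<close>

lemma walks_odd: "walks s a (Suc (2 * m)) b = (\<Sum>c<Suc s - b. walks s a (2 * m) c)"
proof -
  have "{c. c \<le> s \<and> c + b \<le> s + \<delta> (Suc (2 * m))} = {..<Suc s - b}"
    by (auto simp: \<delta>_def)
  then show ?thesis by simp
qed

text \<open>
  Raising the endpoint \<open>b\<close> by one loses exactly one admissible predecessor, \<open>s + 1 - b\<close> (none if \<open>b = 0\<close>), and the walks
  reaching this predecessor are those that stood below \<open>b\<close> one step earlier.
\<close>

lemma walks_even_diff:
  assumes "b \<le> s"
  shows "walks s a (2 * Suc m) b = walks s a (2 * Suc m) (Suc b) + (\<Sum>c<b. walks s a (2 * m) c)"
proof (cases "b = 0")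
  case True
  then have "{c. c \<le> s \<and> c + b \<le> s + \<delta> (Suc (Suc (2 * m)))} =
      {c. c \<le> s \<and> c + Suc b \<le> s + \<delta> (Suc (Suc (2 * m)))}"
    by (auto simp: \<delta>_def)
  with True show ?thesis
    by (simp del: walks.simps add: walks.simps(2)[of s a "Suc (2 * m)"])
next
  case False
  have "{c. c \<le> s \<and> c + b \<le> s + \<delta> (Suc (Suc (2 * m)))} =
      insert (Suc s - b) {c. c \<le> s \<and> c + Suc b \<le> s + \<delta> (Suc (Suc (2 * m)))}"
    using False assms by (auto simp: \<delta>_def)
  moreover have "Suc s - b \<notin> {c. c \<le> s \<and> c + Suc b \<le> s + \<delta> (Suc (Suc (2 * m)))}"
    using assms by (auto simp: \<delta>_def)
  moreover have "Suc s - (Suc s - b) = b" using assms by simp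
  ultimately show ?thesis
    by (simp del: walks.simps add: walks.simps(2)[of s a "Suc (2 * m)"] walks_odd)
qed

lemma walks_even_boundary: "walks s a (2 * Suc m) (Suc s) = (\<Sum>c<Suc s. walks s a (2 * m) c)"
proof -
  have "{c. c \<le> s \<and> c + Suc s \<le> s + \<delta> (Suc (Suc (2 * m)))} = {0}"
    by (auto simp: \<delta>_def)
  then show ?thesis
    by (simp del: walks.simps add: walks.simps(2)[of s a "Suc (2 * m)"] walks_odd)
qed

definition walk_gf :: "nat \<Rightarrow> nat \<Rightarrow> nat \<Rightarrow> real fps" where
  "walk_gf s a b = Abs_fps (\<lambda>m. real (walks s a (2 * m) b))"

lemma walk_gf_diff:
  assumes "b \<le> s"
  shows "walk_gf s a b = walk_gf s a (Suc b) + fps_X * (\<Sum>c<b. walk_gf s a c)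
           + (if a = b then 1 else 0) - (if a = Suc b then 1 else 0)"
proof (rule fps_ext)
  fix n
  show "fps_nth (walk_gf s a b) n = fps_nth (walk_gf s a (Suc b) + fps_X * (\<Sum>c<b. walk_gf s a c)
           + (if a = b then 1 else 0) - (if a = Suc b then 1 else 0)) n"
  proof (cases n)
    case 0
    then show ?thesis by (auto simp: walk_gf_def)
  next
    case (Suc m)
    then show ?thesis
      using walks_even_diff[OF assms, of a m]
      by (simp del: walks.simps mult_Suc_right add: walk_gf_def fps_sum_nth)
  qed
qed

lemma walk_gf_boundary:
  assumes "a \<le> s"
  shows "walk_gf s a (Suc s) = fps_X * (\<Sum>c<Suc s. walk_gf s a c)"
proof (rule fps_ext)
  fix n
  show "fps_nth (walk_gf s a (Suc s)) n = fps_nth (fps_X * (\<Sum>c<Suc s. walk_gf s a c)) n"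
  proof (cases n)
    case 0
    then show ?thesis using assms by (auto simp: walk_gf_def)
  next
    case (Suc m)
    then show ?thesis
      using walks_even_boundary[of s a m]
      by (simp del: walks.simps mult_Suc_right sum.lessThan_Suc add: walk_gf_def fps_sum_nth)
  qed
qed

text \<open>
  The partial sums solve an inhomogeneous linear recurrence of order two. The multiple of \<open>r\<^sub>k\<close> is the
  homogeneous solution vanishing at \<open>0\<close>. The source terms at \<open>k = a - 1\<close> and \<open>k = a\<close> together start
  the solution \<open>q\<close> at \<open>k = a + 1\<close>, since \<open>q\<^sub>0 = q\<^sub>1 = 1\<close>. For \<open>a = 0\<close> the first source term
  lies outside the range, which is why \<open>h(0)\<close> is then corrected by \<open>1\<close>.
\<close>

lemma sum_walk_gf:
  assumes "k \<le> Suc (Suc s)"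
  shows "(\<Sum>c<k. walk_gf s a c) =
    (walk_gf s a 0 - (if a = 0 then 1 else 0)) * R_fps k + (if a < k then Q_fps (k - Suc a) else 0)"
  using assms
proof (induction k rule: induct_nat_012)
  case 0
  show ?case by simp
next
  case 1
  show ?case by (simp add: R_fps_Suc)
next
  case (ge2 k)
  define \<alpha> where "\<alpha> = walk_gf s a 0 - (if a = 0 then 1 else 0)"
  define H where "H = (\<lambda>k. \<Sum>c<k. walk_gf s a c)"
  define P where "P = (\<lambda>k. if a < k then Q_fps (k - Suc a) else 0)"
  have k: "k \<le> s" using ge2.prems by simp
  have H: "H k = \<alpha> * R_fps k + P k" "H (Suc k) = \<alpha> * R_fps (Suc k) + P (Suc k)"
    using ge2 by (simp_all add: H_def \<alpha>_def P_def)
  define e where "e = (if a = Suc k then 1 else 0) - (if a = k then 1 else 0 :: real fps)"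
  have "H (Suc (Suc k)) = 2 * H (Suc k) - (1 + fps_X) * H k + e"
    using walk_gf_diff[OF k, of a] by (simp add: H_def e_def algebra_simps)
  also have "\<dots> = \<alpha> * R_fps (Suc (Suc k)) + (2 * P (Suc k) - (1 + fps_X) * P k + e)"
    unfolding H R_fps_Suc_Suc by (simp add: algebra_simps)
  also have "2 * P (Suc k) - (1 + fps_X) * P k + e = P (Suc (Suc k))"
  proof (cases "a < k")
    case True
    then obtain n where "k = Suc (a + n)" by (metis less_iff_Suc_add)
    then show ?thesis by (simp add: P_def e_def Q_fps_Suc_Suc)
  next
    case False
    then consider "a = k" | "a = Suc k" | "a > Suc k" by linarith
    then show ?thesis by cases (simp_all add: P_def e_def Q_fps_Suc)
  qed
  finally show ?case by (simp add: H_def \<alpha>_def P_def)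
qed

text \<open>
  The coefficient \<open>\<alpha>\<close> of the homogeneous solution is determined by \<open>H(s + 2) = (1 + y) H(s + 1)\<close>, the
  boundary condition in terms of the partial sums \<open>H\<close>; the homogeneous solution misses it
  by \<open>r\<^sub>s\<^sub>+\<^sub>2 - (1 + y) r\<^sub>s\<^sub>+\<^sub>1 = q\<^sub>s\<^sub>+\<^sub>2\<close>. The factor \<open>fps_X\<close> on the right accounts for the shift of
  exponents between \<open>\<Psi>\<^sub>s\<close>, \<open>\<Omega>\<^sub>s\<close> and sums of \<open>walk_gf\<close>.
\<close>

lemma walk_gf_closed_form:
  assumes "a \<le> s" "b \<le> s"
  shows "Q_fps (s + 2) * (walk_gf s a b - (if a = b then 1 else 0)) =
    fps_X * (R_fps (Suc s - a) * Q_fps b - (if a < b then Q_fps (s + 2) * R_fps (b - Suc a) else 0))"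
proof -
  define \<alpha> where "\<alpha> = walk_gf s a 0 - (if a = 0 then 1 else 0)"
  define H where "H = (\<lambda>k. \<Sum>c<k. walk_gf s a c)"
  have H: "H k = \<alpha> * R_fps k + (if a < k then Q_fps (k - Suc a) else 0)" if "k \<le> Suc (Suc s)" for k
    using sum_walk_gf[OF that] by (simp add: H_def \<alpha>_def)
  have "H (Suc (Suc s)) = (1 + fps_X) * H (Suc s)"
    using walk_gf_boundary[OF assms(1)] by (simp add: H_def algebra_simps)
  then have "\<alpha> * (R_fps (Suc (Suc s)) - (1 + fps_X) * R_fps (Suc s)) =
      (1 + fps_X) * Q_fps (s - a) - Q_fps (Suc (s - a))"
    using assms(1) by (simp add: H Suc_diff_le algebra_simps)
  moreover have "R_fps (Suc (Suc s)) - (1 + fps_X) * R_fps (Suc s) = Q_fps (s + 2)"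
    by (simp add: Q_fps_Suc R_fps_Suc algebra_simps)
  moreover have "(1 + fps_X) * Q_fps (s - a) - Q_fps (Suc (s - a)) = fps_X * R_fps (Suc s - a)"
    using assms(1) by (simp add: Suc_diff_le Q_fps_Suc R_fps_Suc algebra_simps)
  ultimately have \<alpha>: "Q_fps (s + 2) * \<alpha> = fps_X * R_fps (Suc s - a)"
    by (simp add: mult.commute)
  have "walk_gf s a b = H (Suc b) - H b" by (simp add: H_def)
  also have "\<dots> = \<alpha> * Q_fps b +
      ((if a < Suc b then Q_fps (b - a) else 0) - (if a < b then Q_fps (b - Suc a) else 0))"
    using assms(2) by (simp add: H R_fps_Suc algebra_simps)
  also have "(if a < Suc b then Q_fps (b - a) else 0) - (if a < b then Q_fps (b - Suc a) else 0) =
      (if a = b then 1 else 0) - fps_X * (if a < b then R_fps (b - Suc a) else 0)"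
  proof (cases "a < b")
    case True
    then obtain n where "b = Suc (a + n)" by (metis less_iff_Suc_add)
    then show ?thesis by (simp add: Q_fps_Suc)
  qed auto
  finally have eq: "walk_gf s a b - (if a = b then 1 else 0) =
      \<alpha> * Q_fps b - fps_X * (if a < b then R_fps (b - Suc a) else 0)" by simp
  have "Q_fps (s + 2) * (walk_gf s a b - (if a = b then 1 else 0)) =
      (Q_fps (s + 2) * \<alpha>) * Q_fps b -
      fps_X * (Q_fps (s + 2) * (if a < b then R_fps (b - Suc a) else 0))"
    unfolding eq by (simp only: algebra_simps)
  also have "Q_fps (s + 2) * (if a < b then R_fps (b - Suc a) else 0) =
      (if a < b then Q_fps (s + 2) * R_fps (b - Suc a) else 0)" by simp
  finally show ?thesis unfolding \<alpha> by (simp only: right_diff_distrib mult.assoc)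
qed

section \<open>Closed forms of the cyclic generating functions\<close>

lemma Psi_cyc_closed_form:
  assumes "s \<ge> 1"
  shows "2 * Q_fps (s + 2) * Psi_cyc s = of_nat (s + 2) * R_fps (s + 1)"
proof -
  have trace: "fps_X * Psi_cyc s = (\<Sum>a\<le>s. walk_gf s a a - 1)"
  proof (rule fps_ext)
    fix n
    show "fps_nth (fps_X * Psi_cyc s) n = fps_nth (\<Sum>a\<le>s. walk_gf s a a - 1) n"
    proof (cases n)
      case 0
      then show ?thesis by (simp add: fps_sum_nth walk_gf_def)
    next
      case (Suc m)
      have "N_cyc (2 * (m + 1)) s = (\<Sum>a\<le>s. walks s a (2 * Suc m) a)"
        using N_cyc_eq_sum_walks[of "Suc (2 * m)" s] by simp
      then show ?thesis
        using assms Suc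
        by (simp del: walks.simps mult_Suc_right add: fps_sum_nth walk_gf_def Psi_cyc_def)
    qed
  qed
  have "fps_X * (Q_fps (s + 2) * Psi_cyc s) = (\<Sum>a\<le>s. Q_fps (s + 2) * (walk_gf s a a - 1))"
    unfolding mult.left_commute[of fps_X] trace by (rule sum_distrib_left)
  also have "\<dots> = (\<Sum>a\<le>s. fps_X * (Q_fps a * R_fps (Suc s - a)))"
  proof (intro sum.cong refl)
    fix a assume "a \<in> {..s}"
    then show "Q_fps (s + 2) * (walk_gf s a a - 1) = fps_X * (Q_fps a * R_fps (Suc s - a))"
      using walk_gf_closed_form[of a s a] by (simp add: mult.commute[of "Q_fps a"])
  qed
  also have "\<dots> = fps_X * (\<Sum>a\<le>s. Q_fps a * R_fps (Suc s - a))"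
    by (rule sum_distrib_left[symmetric])
  finally have "Q_fps (s + 2) * Psi_cyc s = (\<Sum>a\<le>s. Q_fps a * R_fps (Suc s - a))"
    by simp
  also have "\<dots> = fps_of_poly (\<Sum>a\<le>Suc s. Q_neg a * R_neg (Suc s - a))"
    by (simp add: fps_of_poly_sum fps_of_poly_mult)
  finally have "2 * Q_fps (s + 2) * Psi_cyc s =
      fps_of_poly (2 * (\<Sum>a\<le>Suc s. Q_neg a * R_neg (Suc s - a)))"
    by (simp add: fps_of_poly_mult mult.assoc)
  also have "\<dots> = fps_of_poly (of_nat (Suc (Suc s)) * R_neg (Suc s))"
    by (simp only: sum_Q_neg_R_neg)
  also have "\<dots> = of_nat (s + 2) * R_fps (s + 1)"
    by (simp add: of_nat_mult_conv_smult fps_of_poly_smult fps_of_nat del: of_nat_Suc)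
  finally show ?thesis .
qed

text \<open>
  A closed walk of odd length is a walk of even length from \<open>a\<close> to some \<open>b\<close> followed by one step
  \<open>a + b \<le> s\<close>. So \<open>\<Omega>\<^sub>s\<close> is a sum of resolvent entries, each of which has denominator \<open>q\<^sub>s\<^sub>+\<^sub>2\<close>.
\<close>

lemma Omega_cyc_numerator:
  "\<exists>A. fps_of_poly A = Q_fps (s + 2) * Omega_cyc s"
proof -
  define A where "A = (\<Sum>a\<le>s. \<Sum>b<Suc s - a. R_neg (Suc s - a) * Q_neg b -
      (if a < b then Q_neg (s + 2) * R_neg (b - Suc a) else 0))"
  have trace: "fps_X * Omega_cyc s =
      (\<Sum>a\<le>s. \<Sum>b<Suc s - a. walk_gf s a b - (if a = b then 1 else 0))"
  proof (rule fps_ext)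
    fix n
    show "fps_nth (fps_X * Omega_cyc s) n =
        fps_nth (\<Sum>a\<le>s. \<Sum>b<Suc s - a. walk_gf s a b - (if a = b then 1 else 0)) n"
    proof (cases n)
      case 0
      then show ?thesis by (auto simp: fps_sum_nth walk_gf_def intro!: sum.neutral)
    next
      case (Suc m)
      have "N_cyc (2 * (m + 1) + 1) s = (\<Sum>a\<le>s. walks s a (Suc (2 * Suc m)) a)"
        using N_cyc_eq_sum_walks[of "2 * Suc m" s] by simp
      also have "\<dots> = (\<Sum>a\<le>s. \<Sum>b<Suc s - a. walks s a (2 * Suc m) b)"
        by (simp only: walks_odd)
      finally have "real (N_cyc (2 * (m + 1) + 1) s) =
          (\<Sum>a\<le>s. \<Sum>b<Suc s - a. real (walks s a (2 * Suc m) b))" by simp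
      moreover have "fps_nth (walk_gf s a b - (if a = b then 1 else 0)) (Suc m) =
          real (walks s a (2 * Suc m) b)" for a b
        by (simp del: walks.simps mult_Suc_right add: walk_gf_def)
      ultimately show ?thesis
        using Suc by (simp only: fps_sum_nth Omega_cyc_def) simp
    qed
  qed
  have "fps_X * (Q_fps (s + 2) * Omega_cyc s) =
      (\<Sum>a\<le>s. \<Sum>b<Suc s - a. Q_fps (s + 2) * (walk_gf s a b - (if a = b then 1 else 0)))"
    unfolding mult.left_commute[of fps_X] trace sum_distrib_left ..
  also have "\<dots> = (\<Sum>a\<le>s. \<Sum>b<Suc s - a. fps_X * fps_of_poly (R_neg (Suc s - a) * Q_neg b -
      (if a < b then Q_neg (s + 2) * R_neg (b - Suc a) else 0)))"
  proof (intro sum.cong refl)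
    fix a b assume "a \<in> {..s}" "b \<in> {..<Suc s - a}"
    then have "a \<le> s" "b \<le> s" by auto
    then show "Q_fps (s + 2) * (walk_gf s a b - (if a = b then 1 else 0)) =
        fps_X * fps_of_poly (R_neg (Suc s - a) * Q_neg b -
          (if a < b then Q_neg (s + 2) * R_neg (b - Suc a) else 0))"
      by (simp only: walk_gf_closed_form fps_of_poly_diff fps_of_poly_mult fps_of_poly_0 if_distrib[of fps_of_poly])
  qed
  also have "\<dots> = fps_X * fps_of_poly A"
    by (simp only: A_def fps_of_poly_sum sum_distrib_left)
  finally have "Q_fps (s + 2) * Omega_cyc s = fps_of_poly A" by simp
  then show ?thesis by metis
qed

section \<open>Linear recurrences and the recursion in \<open>s\<close>\<close>

text \<open>
  The recurrence at \<open>m\<close> says that \<open>Q_fps (s + 2) * F\<close> has vanishing coefficient at \<open>y\<^sup>m\<^sup>-\<^sup>1\<close>, an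
  exponent exceeding the degree of the numerator as soon as \<open>m \<ge> degree A + 2\<close>.
\<close>

lemma cyc_recurrence_at_of_numerator:
  assumes "fps_of_poly A = Q_fps (s + 2) * F"
    and a: "\<And>k. a (Suc k) = fps_nth F k"
    and m: "m \<ge> degree A + 2"
  shows "cyc_recurrence_at s a m"
proof -
  define c where "c = (\<lambda>j. (-1) ^ j * real ((s + 2) choose (2 * j)))"
  define g where "g = (\<lambda>j. c j * (if j < m then a (m - j) else 0))"
  have "0 = fps_nth (Q_fps (s + 2) * F) (m - 1)"
    unfolding assms(1)[symmetric] using m by (simp add: coeff_eq_0)
  also have "\<dots> = (\<Sum>j = 0..m - 1. c j * fps_nth F (m - 1 - j))"
    by (simp add: fps_mult_nth coeff_Q_neg c_def)
  also have "\<dots> = (\<Sum>j = 0..m - 1. g j)"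
  proof (intro sum.cong refl)
    fix j assume "j \<in> {0..m - 1}"
    then have "j < m" "m - j = Suc (m - 1 - j)" using m by auto
    then show "c j * fps_nth F (m - 1 - j) = g j"
      by (simp only: g_def a if_True)
  qed
  \<comment> \<open>\<open>g\<close> vanishes both for \<open>j \<ge> m\<close> and for \<open>j > \<nu> s\<close>, so the two ranges agree inside a common larger one.\<close>
  also have "\<dots> = (\<Sum>j = 0..\<nu> s + m. g j)"
    by (rule sum.mono_neutral_left) (auto simp: g_def)
  also have "\<dots> = (\<Sum>j = 0..\<nu> s. g j)"
  proof (rule sum.mono_neutral_right)
    show "\<forall>j\<in>{0..\<nu> s + m} - {0..\<nu> s}. g j = 0"
      by (auto simp: g_def c_def \<nu>_def binomial_eq_0)
  qed auto
  also have "\<dots> = a m + (\<Sum>j = 1..\<nu> s. g j)"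
    using m by (simp add: sum.atLeast_Suc_atMost g_def c_def)
  finally have "a m = (\<Sum>j = 1..\<nu> s. - g j)" by (simp add: sum_negf)
  then show ?thesis
    by (simp add: cyc_recurrence_at_def g_def c_def)
qed

lemma fps_eq_divide_iff:
  fixes F N D :: "real fps"
  assumes "fps_nth D 0 \<noteq> 0"
  shows "F = N / D \<longleftrightarrow> N = D * F"
proof -
  have inv: "D * inverse D = 1" using assms by (simp add: inverse_mult_eq_1')
  show ?thesis
  proof
    assume "F = N / D"
    then have "D * F = N * (D * inverse D)"
      by (simp only: fps_divide_unit[OF assms] mult_ac)
    with inv show "N = D * F" by simp
  next
    assume "N = D * F"
    then have "N / D = F * (D * inverse D)"
      by (simp only: fps_divide_unit[OF assms] mult_ac)
    with inv show "F = N / D" by simp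
  qed
qed

lemma Psi_eq_Psi_hat: "2 * Psi_cyc s = of_nat (s + 2) * Psi_hat_cyc s"
proof (cases "s = 0")
  case True
  then show ?thesis by (simp add: Psi_cyc_def Psi_hat_cyc_def)
next
  case False
  have "of_nat (s + 2) * fps_const (2 / (real s + 2)) = fps_const (real (s + 2) * (2 / (real s + 2)))"
    by (simp only: fps_of_nat[symmetric] fps_const_mult)
  also have "real (s + 2) * (2 / (real s + 2)) = 2"
    by (simp add: field_simps)
  also have "fps_const (2 :: real) = 2"
    by (rule numeral_fps_const[symmetric])
  finally have "of_nat (s + 2) * (fps_const (2 / (real s + 2)) * Psi_cyc s) = 2 * Psi_cyc s"
    by (simp only: mult.assoc[symmetric])
  with False show ?thesis by (simp add: Psi_hat_cyc_def)
qed

text \<open>The convention at \<open>s = 0\<close> fits: \<open>r\<^sub>1 / q\<^sub>2 = 1 / (1 - y)\<close>, so the recursion can start there.\<close>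

lemma Psi_hat_cyc_closed_form: "Q_fps (s + 2) * Psi_hat_cyc s = R_fps (s + 1)"
proof (cases "s = 0")
  case True
  have "Psi_hat_cyc 0 = 1 / (1 - fps_X)" by (simp add: Psi_hat_cyc_def)
  then have "1 = (1 - fps_X) * Psi_hat_cyc 0"
    using fps_eq_divide_iff[of "1 - fps_X" "Psi_hat_cyc 0" 1] by simp
  then show ?thesis using True by (simp add: Q_fps_Suc R_fps_Suc numeral_2_eq_2)
next
  case False
  have "of_nat (s + 2) * (Q_fps (s + 2) * Psi_hat_cyc s) = Q_fps (s + 2) * (2 * Psi_cyc s)"
    unfolding Psi_eq_Psi_hat by (simp only: mult.left_commute)
  also have "\<dots> = of_nat (s + 2) * R_fps (s + 1)"
    using Psi_cyc_closed_form[of s] False by (simp only: mult_ac)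
  finally have "of_nat (s + 2) * (Q_fps (s + 2) * Psi_hat_cyc s) = of_nat (s + 2) * R_fps (s + 1)" .
  moreover have "of_nat (s + 2) \<noteq> (0 :: real fps)"
    by (simp only: fps_of_nat[symmetric] fps_const_eq_0_iff)
  ultimately show ?thesis by (simp only: mult_cancel_left) simp
qed

theorem theorem1p5:
  fixes s :: nat
  assumes "s \<ge> 1"
  shows
    "Psi_hat_cyc s =
       (1 + (1 + fps_X) * Psi_hat_cyc (s - 1)) /
       (1 - fps_X - fps_X * (1 + fps_X) * Psi_hat_cyc (s - 1))
     \<and>
     Psi_cyc s =
       (of_nat (s + 2) * (of_nat (s + 1) + 2 * (1 + fps_X) * Psi_cyc (s - 1))) /
       (2 * (of_nat (s + 1) * (1 - fps_X) - 2 * fps_X * (1 + fps_X) * Psi_cyc (s - 1)))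
     \<and>
     Q_neg (s + 2) = (\<Sum>j = 0..\<nu> s. monom ((-1) ^ j * real ((s + 2) choose (2 * j))) j)
     \<and>
     (\<forall>F \<in> {Psi_cyc s, Omega_cyc s}. \<forall>A :: real poly.
        F = fps_of_poly A / fps_of_poly (Q_neg (s + 2)) \<longrightarrow>
        (\<forall>m \<ge> degree A + 2. cyc_recurrence_at s (\<lambda>m. fps_nth F (m - 1)) m))
     \<and>
     (\<forall>m \<ge> \<nu> s + 1. cyc_recurrence_at s (\<lambda>m. real (N_cyc (2 * m) s)) m)
     \<and>
     (\<exists>A :: real poly.
        fps_of_poly A = fps_of_poly (Q_neg (s + 2)) * Omega_cyc s \<and>
        (\<forall>m \<ge> degree A + 2. cyc_recurrence_at s (\<lambda>m. real (N_cyc (2 * m + 1) s)) m))"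
proof (intro conjI)
  obtain t where s: "s = Suc t" using assms by (cases s) auto
  define P where "P = Psi_hat_cyc t"
  define D where "D = 1 - fps_X - fps_X * (1 + fps_X) * P"
  have P: "Q_fps (Suc s) * P = R_fps s"
    using Psi_hat_cyc_closed_form[of t] by (simp add: s P_def)
  \<comment> \<open>Multiplied by \<open>q\<^sub>s\<^sub>+\<^sub>1\<close>, numerator and denominator of the recursion become \<open>r\<^sub>s\<^sub>+\<^sub>1\<close> and \<open>q\<^sub>s\<^sub>+\<^sub>2\<close>.\<close>
  have N: "Q_fps (Suc s) * (1 + (1 + fps_X) * P) = R_fps (s + 1)"
  proof -
    have "Q_fps (Suc s) * (1 + (1 + fps_X) * P) = Q_fps (Suc s) + (1 + fps_X) * R_fps s"
      unfolding P[symmetric] by (simp add: algebra_simps)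
    then show ?thesis by (simp add: Q_fps_Suc R_fps_Suc algebra_simps)
  qed
  have D: "Q_fps (Suc s) * D = Q_fps (s + 2)"
  proof -
    have "Q_fps (Suc s) * D = (1 - fps_X) * Q_fps (Suc s) - fps_X * (1 + fps_X) * R_fps s"
      unfolding P[symmetric] D_def by (simp add: algebra_simps)
    then show ?thesis by (simp add: Q_fps_Suc R_fps_Suc algebra_simps)
  qed
  have "Q_fps (Suc s) * (D * Psi_hat_cyc s) = Q_fps (Suc s) * (1 + (1 + fps_X) * P)"
    unfolding N mult.assoc[symmetric] D by (rule Psi_hat_cyc_closed_form)
  then have hat: "1 + (1 + fps_X) * P = D * Psi_hat_cyc s"
    using Q_fps_nonzero by simp
  then have "Psi_hat_cyc s = (1 + (1 + fps_X) * P) / D"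
    by (subst fps_eq_divide_iff) (simp_all add: D_def)
  then show "Psi_hat_cyc s = (1 + (1 + fps_X) * Psi_hat_cyc (s - 1)) /
       (1 - fps_X - fps_X * (1 + fps_X) * Psi_hat_cyc (s - 1))"
    by (simp add: s P_def D_def)
  have t: "2 * Psi_cyc (s - 1) = of_nat (s + 1) * P"
    using Psi_eq_Psi_hat[of t] by (simp add: s P_def)
  \<comment> \<open>The second form of the recursion is the first with \<open>2 \<Psi>\<^sub>s\<close> and \<open>2 \<Psi>\<^sub>s\<^sub>-\<^sub>1\<close> substituted.\<close>
  have "of_nat (s + 2) * (of_nat (s + 1) + 2 * (1 + fps_X) * Psi_cyc (s - 1)) =
      of_nat (s + 2) * (of_nat (s + 1) + (1 + fps_X) * (2 * Psi_cyc (s - 1)))"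
    by (simp only: mult_ac)
  also have "\<dots> = of_nat (s + 1) * of_nat (s + 2) * (1 + (1 + fps_X) * P)"
    unfolding t by (simp only: algebra_simps mult_1)
  also have "\<dots> = of_nat (s + 1) * D * (of_nat (s + 2) * Psi_hat_cyc s)"
    unfolding hat by (simp only: mult_ac)
  also have "\<dots> = 2 * (of_nat (s + 1) * D) * Psi_cyc s"
    unfolding Psi_eq_Psi_hat[symmetric] by (simp only: mult_ac)
  also have eq: "of_nat (s + 1) * D =
      of_nat (s + 1) * (1 - fps_X) - 2 * fps_X * (1 + fps_X) * Psi_cyc (s - 1)"
  proof -
    have "of_nat (s + 1) * D = of_nat (s + 1) * (1 - fps_X) - fps_X * (1 + fps_X) * (2 * Psi_cyc (s - 1))"
      unfolding t D_def by (simp only: algebra_simps mult_1)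
    then show ?thesis by (simp only: mult_ac)
  qed
  finally have numerator: "of_nat (s + 2) * (of_nat (s + 1) + 2 * (1 + fps_X) * Psi_cyc (s - 1)) =
      2 * (of_nat (s + 1) * (1 - fps_X) - 2 * fps_X * (1 + fps_X) * Psi_cyc (s - 1)) * Psi_cyc s" .
  have "fps_nth (2 * (of_nat (s + 1) * D)) 0 = 2 * real (s + 1)"
    by (simp only: fps_mult_nth_0 fps_numeral_nth_0 fps_nth_of_nat) (simp add: D_def)
  then have "fps_nth (2 * (of_nat (s + 1) * D)) 0 \<noteq> 0" by simp
  then show "Psi_cyc s =
       (of_nat (s + 2) * (of_nat (s + 1) + 2 * (1 + fps_X) * Psi_cyc (s - 1))) /
       (2 * (of_nat (s + 1) * (1 - fps_X) - 2 * fps_X * (1 + fps_X) * Psi_cyc (s - 1)))"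
    unfolding eq using fps_eq_divide_iff numerator by blast
  show "Q_neg (s + 2) = (\<Sum>j = 0..\<nu> s. monom ((-1) ^ j * real ((s + 2) choose (2 * j))) j)"
    by (simp only: Q_neg_eq_sum \<nu>_def)
  show "\<forall>F \<in> {Psi_cyc s, Omega_cyc s}. \<forall>A :: real poly.
        F = fps_of_poly A / fps_of_poly (Q_neg (s + 2)) \<longrightarrow>
        (\<forall>m \<ge> degree A + 2. cyc_recurrence_at s (\<lambda>m. fps_nth F (m - 1)) m)"
  proof (intro ballI allI impI)
    fix F A m
    assume "F = fps_of_poly A / Q_fps (s + 2)" and m: "degree A + 2 \<le> m"
    then have "fps_of_poly A = Q_fps (s + 2) * F"
      using fps_eq_divide_iff[of "Q_fps (s + 2)" F "fps_of_poly A"] Q_fps_nth_0 by simp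
    then show "cyc_recurrence_at s (\<lambda>m. fps_nth F (m - 1)) m"
      by (rule cyc_recurrence_at_of_numerator) (use m in auto)
  qed
  show "\<forall>m \<ge> \<nu> s + 1. cyc_recurrence_at s (\<lambda>m. real (N_cyc (2 * m) s)) m"
  proof (intro allI impI)
    fix m assume m: "\<nu> s + 1 \<le> m"
    \<comment> \<open>The numerator has degree at most \<open>s div 2 = \<nu> s - 1\<close>, so the recurrence starts at \<open>\<nu> s + 1\<close>.\<close>
    define A where "A = smult (real (s + 2) / 2) (R_neg (s + 1))"
    have "2 * (Q_fps (s + 2) * Psi_cyc s) = 2 * fps_of_poly A"
    proof -
      have "2 * fps_of_poly A = fps_const 2 * fps_const (real (s + 2) / 2) * R_fps (s + 1)"
        by (simp only: A_def fps_of_poly_smult numeral_fps_const mult.assoc)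
      also have "fps_const 2 * fps_const (real (s + 2) / 2) = of_nat (s + 2)"
        by (simp only: fps_of_nat[symmetric] fps_const_mult) simp
      also have "of_nat (s + 2) * R_fps (s + 1) = 2 * (Q_fps (s + 2) * Psi_cyc s)"
        using Psi_cyc_closed_form[OF assms] by (simp only: mult.assoc)
      finally show ?thesis by simp
    qed
    then have "fps_of_poly A = Q_fps (s + 2) * Psi_cyc s" by simp
    moreover have "degree A \<le> s div 2"
      by (rule degree_le) (auto simp: A_def coeff_R_neg binomial_eq_0)
    then have "m \<ge> degree A + 2" using m by (simp add: \<nu>_def)
    ultimately show "cyc_recurrence_at s (\<lambda>m. real (N_cyc (2 * m) s)) m"
      by (intro cyc_recurrence_at_of_numerator) (use assms in \<open>auto simp: Psi_cyc_def\<close>)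
  qed
  obtain A where A: "fps_of_poly A = Q_fps (s + 2) * Omega_cyc s"
    using Omega_cyc_numerator by blast
  moreover have "cyc_recurrence_at s (\<lambda>m. real (N_cyc (2 * m + 1) s)) m" if "m \<ge> degree A + 2" for m
    using A by (rule cyc_recurrence_at_of_numerator) (use that in \<open>auto simp: Omega_cyc_def\<close>)
  ultimately show "\<exists>A :: real poly.
        fps_of_poly A = fps_of_poly (Q_neg (s + 2)) * Omega_cyc s \<and>
        (\<forall>m \<ge> degree A + 2. cyc_recurrence_at s (\<lambda>m. real (N_cyc (2 * m + 1) s)) m)"
    by blast
qed

end
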